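(* Let $p_n\to0$ be a sequence of positive real numbers (in $(0,1)$). Let $I_{p_n}(\theta)$ denote the Fisher information matrix for a single data point with respect to the density $k_{p_n}(\cdot;\theta)$, where $k_p(x;\theta)=(1-p)f(x;\theta)+p\,g(x)$, and let $I(\theta)$ denote the Fisher information matrix with respect to $f(\cdot;\theta)$. Then, entrywise, $$I_{p_n}(\theta^* )\to I(\theta^* )\qquad(n\to\infty).$$
   Context: $\mathcal X$ and $\Omega$ are convex subsets of Euclidean spaces; $f(x;\theta)$, $\theta\in\Omega$, is a family of probability densities on $\mathcal X$; the contamination density $g$ is a probability density with full support over $\mathcal X$; $f$ and $k_p$ are jointly continuous in $(x,\theta)$; $\theta^*\in\Omega$ is the true parameter. The Fisher information matrix of a density family $q(\cdot;\theta)$ is $\mathbb E_{q}\big[(\nabla_\theta\log q(x;\theta))(\nabla_\theta\log q(x;\theta))^\top\big]$.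
   Formalization: The true parameter θ* is assumed to lie in the interior of Ω (at a boundary point the gradient is undefined, and with one-sided derivatives the claim can fail); I(θ* ) is assumed finite and the scores of f and k_{p_n} at θ* to exist almost surely. *)

theory Defs
  imports "HOL-Analysis.Analysis"
begin

definition is_density_on :: "'a::euclidean_space set \<Rightarrow> ('a \<Rightarrow> real) \<Rightarrow> bool" where
  "is_density_on X q \<longleftrightarrow>
     (\<forall>x\<in>X. 0 \<le> q x) \<and> has_bochner_integral (lebesgue_on X) q 1"

definition contaminated ::
    "('a \<Rightarrow> 't \<Rightarrow> real) \<Rightarrow> ('a \<Rightarrow> real) \<Rightarrow> real \<Rightarrow> 'a \<Rightarrow> 't \<Rightarrow> real" where
  "contaminated f g p x \<theta> = (1 - p) * f x \<theta> + p * g x"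

definition gradient :: "('t::real_inner \<Rightarrow> real) \<Rightarrow> 't \<Rightarrow> 't" where
  "gradient h t = (THE D. GDERIV h t :> D)"

definition score :: "('a \<Rightarrow> 't::real_inner \<Rightarrow> real) \<Rightarrow> 't \<Rightarrow> 'a \<Rightarrow> 't" where
  "score q \<theta> x = gradient (\<lambda>t. ln (q x t)) \<theta>"

text \<open>
  The score exists almost surely under the law with density \<open>q(\<cdot>; \<theta>)\<close>. This law ignores the
  points with \<open>q(x; \<theta>) = 0\<close>, where the logarithm is undefined.
\<close>

definition score_exists ::
    "'a::euclidean_space set \<Rightarrow> ('a \<Rightarrow> 't::real_inner \<Rightarrow> real) \<Rightarrow> 't \<Rightarrow> bool" where
  "score_exists X q \<theta> \<longleftrightarrow>
     (AE x in lebesgue_on X. 0 < q x \<theta> \<longrightarrow> (\<lambda>t. ln (q x t)) differentiable (at \<theta>))"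

text \<open>
  Expectations under \<open>q(\<cdot>; \<theta>)\<close> are written as integrals against Lebesgue measure weighted by
  the density, so the value of the score where the density vanishes is irrelevant.
\<close>

definition fisher_information ::
    "'a::euclidean_space set \<Rightarrow> ('a \<Rightarrow> real ^ 'd \<Rightarrow> real) \<Rightarrow> real ^ 'd \<Rightarrow> real ^ 'd ^ 'd" where
  "fisher_information X q \<theta> =
     (\<chi> i j. integral\<^sup>L (lebesgue_on X) (\<lambda>x. (score q \<theta> x $ i * score q \<theta> x $ j) * q x \<theta>))"

definition fisher_information_exists ::
    "'a::euclidean_space set \<Rightarrow> ('a \<Rightarrow> real ^ 'd \<Rightarrow> real) \<Rightarrow> real ^ 'd \<Rightarrow> bool" where
  "fisher_information_exists X q \<theta> \<longleftrightarrow>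
     score_exists X q \<theta> \<and>
     (\<forall>i j. integrable (lebesgue_on X) (\<lambda>x. (score q \<theta> x $ i * score q \<theta> x $ j) * q x \<theta>))"

end

theory Submission
  imports Defs
begin

text \<open>
  Write \<open>k = (1 - p) f + p g\<close>. Where \<open>f(x; \<theta>s) > 0\<close> the chain rule turns the score of \<open>k\<close>
  into \<open>(1 - p) f / k\<close> times the score of \<open>f\<close>. Where \<open>f(x; \<theta>s) = 0\<close> the point \<open>\<theta>s\<close> minimises
  \<open>f(x; \<cdot>) \<ge> 0\<close>, so the score of \<open>k\<close> vanishes if \<open>k > 0\<close>. In all cases the Fisher integrand of \<open>k\<close>
  is that of \<open>f\<close> multiplied by \<open>(1 - p)\<^sup>2 f / k\<close>, a factor in \<open>[0, 1]\<close> that tends to \<open>1\<close>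
  where \<open>f > 0\<close>, and dominated convergence applies.
\<close>

lemma gradient_eqI:
  assumes "GDERIV h t :> D"
  shows "gradient h t = D"
  unfolding gradient_def
proof (rule the_equality[where P = "\<lambda>D. GDERIV h t :> D", OF assms])
  fix E assume "GDERIV h t :> E"
  with assms have "(\<lambda>v. v \<bullet> E) = (\<lambda>v. v \<bullet> D)"
    unfolding gderiv_def by (rule has_derivative_unique[rotated])
  then show "E = D"
    by (simp add: fun_eq_iff vector_eq_ldot)
qed

text \<open>Riesz representation in finite dimension: the derivative is the inner product with the
  vector of its values on \<open>Basis\<close>. This is how \<open>differentiable\<close>, the form
  in which scores are assumed to exist, gives access to the \<open>THE\<close> in
  \<open>gradient\<close>.\<close>

lemma GDERIV_gradient:
  fixes h :: "'t::euclidean_space \<Rightarrow> real"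
  assumes "h differentiable (at t)"
  shows "GDERIV h t :> gradient h t"
proof -
  obtain h' where h': "(h has_derivative h') (at t)"
    using assms differentiable_def by blast
  interpret h': bounded_linear h'
    using h' by (rule has_derivative_bounded_linear)
  have "h' v = v \<bullet> (\<Sum>b\<in>Basis. h' b *\<^sub>R b)" for v
  proof -
    have "h' v = h' (\<Sum>b\<in>Basis. (v \<bullet> b) *\<^sub>R b)"
      by (simp add: euclidean_representation)
    also have "\<dots> = v \<bullet> (\<Sum>b\<in>Basis. h' b *\<^sub>R b)"
      by (simp add: h'.sum h'.scaleR inner_sum_right mult.commute)
    finally show ?thesis .
  qed
  then have "h' = (\<lambda>v. v \<bullet> (\<Sum>b\<in>Basis. h' b *\<^sub>R b))"
    by (rule ext)
  with h' have "GDERIV h t :> (\<Sum>b\<in>Basis. h' b *\<^sub>R b)"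
    unfolding gderiv_def by (rule back_subst[where P = "\<lambda>F. (h has_derivative F) (at t)"])
  then show ?thesis
    by (simp only: gradient_eqI)
qed

text \<open>Continuity keeps \<open>u\<close> positive near \<open>t\<close>, so there
  \<open>u\<close> is \<open>exp\<close> of its logarithm and the chain rule applies. The
  assumptions concern only log densities; this recovers derivatives of the densities
  themselves.\<close>

lemma GDERIV_of_ln:
  fixes u :: "'t::euclidean_space \<Rightarrow> real"
  assumes "isCont u t" and "0 < u t" and "(\<lambda>s. ln (u s)) differentiable (at t)"
  shows "GDERIV u t :> u t *\<^sub>R gradient (\<lambda>s. ln (u s)) t"
proof -
  have "GDERIV (\<lambda>s. exp (ln (u s))) t :> exp (ln (u t)) *\<^sub>R gradient (\<lambda>s. ln (u s)) t"
    by (rule GDERIV_DERIV_compose[OF GDERIV_gradient[OF assms(3)] DERIV_exp])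
  then have "((\<lambda>s. exp (ln (u s))) has_derivative
      (\<lambda>v. v \<bullet> (u t *\<^sub>R gradient (\<lambda>s. ln (u s)) t))) (at t)"
    using assms(2) by (simp add: gderiv_def)
  moreover have "eventually (\<lambda>s. exp (ln (u s)) = u s) (at t)"
    using order_tendstoD(1)[OF assms(1)[unfolded isCont_def] assms(2)]
    by eventually_elim simp
  moreover have "exp (ln (u t)) = u t"
    using assms(2) by simp
  ultimately show ?thesis
    unfolding gderiv_def by (rule has_derivative_transform_eventually) simp
qed

text \<open>Pointwise core, to be used with \<open>u = f x\<close>, \<open>c = g x\<close> and
  \<open>r = p n\<close>. Differentiability is assumed only under positivity, to match
  \<open>score_exists\<close>.\<close>

lemma fisher_integrand_mixture:
  fixes u :: "real ^ 'd \<Rightarrow> real"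
  defines "k \<equiv> \<lambda>r c t. (1 - r) * u t + r * c"
  assumes cont: "isCont u t" and nonneg: "eventually (\<lambda>s. 0 \<le> u s) (nhds t)"
    and c: "0 \<le> c" and r: "0 < r" "r < 1"
    and du: "0 < u t \<Longrightarrow> (\<lambda>s. ln (u s)) differentiable (at t)"
    and dk: "0 < k r c t \<Longrightarrow> (\<lambda>s. ln (k r c s)) differentiable (at t)"
  shows "gradient (\<lambda>s. ln (k r c s)) t $ i * gradient (\<lambda>s. ln (k r c s)) t $ j * k r c t =
    gradient (\<lambda>s. ln (u s)) t $ i * gradient (\<lambda>s. ln (u s)) t $ j * u t
      * ((1 - r)\<^sup>2 * u t / k r c t)"
proof -
  have u0: "0 \<le> u t"
    using nonneg by (rule eventually_nhds_x_imp_x)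
  consider "0 < u t" | "u t = 0" "0 < c" | "u t = 0" "c = 0"
    using u0 c by linarith
  then show ?thesis
  proof cases
    case 1
    let ?D = "gradient (\<lambda>s. ln (u s)) t"
    have kpos: "0 < k r c t"
      unfolding k_def using 1 r c by (simp add: add_pos_nonneg)
    have "((\<lambda>s. (1 - r) * u s + r * c) has_derivative (\<lambda>v. (1 - r) * (v \<bullet> (u t *\<^sub>R ?D)) + 0)) (at t)"
      using GDERIV_of_ln[OF cont 1 du[OF 1]] unfolding gderiv_def
      by (intro has_derivative_add has_derivative_mult_right has_derivative_const)
    then have "GDERIV (k r c) t :> ((1 - r) * u t) *\<^sub>R ?D"
      by (simp add: gderiv_def k_def mult.assoc)
    then have "GDERIV (\<lambda>s. ln (k r c s)) t :> inverse (k r c t) *\<^sub>R ((1 - r) * u t) *\<^sub>R ?D"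
      by (rule GDERIV_DERIV_compose) (rule DERIV_ln[OF kpos])
    then have "gradient (\<lambda>s. ln (k r c s)) t = inverse (k r c t) *\<^sub>R ((1 - r) * u t) *\<^sub>R ?D"
      by (rule gradient_eqI)
    \<comment> \<open>Two of these factors times one \<open>k r c t\<close> leave \<open>u t\<close>
      times the claimed weight.\<close>
    then have "gradient (\<lambda>s. ln (k r c s)) t $ l = (1 - r) * u t / k r c t * ?D $ l" for l
      by (simp add: divide_inverse mult.assoc mult.left_commute)
    then show ?thesis
      using kpos by (simp add: power2_eq_square)
  next
    case 2
    have kpos: "0 < k r c t"
      unfolding k_def using 2 r by simp
    have contk: "isCont (k r c) t"
      unfolding k_def using cont by (intro continuous_intros)
    \<comment> \<open>Since \<open>u t = 0\<close>, nothing is known about the logarithm of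
      \<open>u\<close> here; the derivative of the mixture comes from \<open>dk\<close>.\<close>
    have "GDERIV (k r c) t :> k r c t *\<^sub>R gradient (\<lambda>s. ln (k r c s)) t"
      by (rule GDERIV_of_ln[OF contk kpos dk[OF kpos]])
    moreover have "eventually (\<lambda>s. k r c t \<le> k r c s) (at t)"
    proof -
      have "eventually (\<lambda>s. 0 \<le> u s) (at t)"
        using nonneg by (simp add: eventually_nhds_conv_at)
      then show ?thesis
        by eventually_elim (use 2 r in \<open>simp add: k_def\<close>)
    qed
    ultimately have "(\<lambda>v. v \<bullet> (k r c t *\<^sub>R gradient (\<lambda>s. ln (k r c s)) t)) = (\<lambda>v. 0)"
      unfolding gderiv_def by (rule has_derivative_local_min)
    \<comment> \<open>Evaluating the zero functional at its own representing vector gives squared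
      norm zero.\<close>
    from fun_cong[OF this, of "k r c t *\<^sub>R gradient (\<lambda>s. ln (k r c s)) t"]
    have "k r c t *\<^sub>R gradient (\<lambda>s. ln (k r c s)) t = 0"
      by (simp only: inner_eq_zero_iff)
    with kpos have "gradient (\<lambda>s. ln (k r c s)) t = 0"
      by simp
    with 2 show ?thesis
      by simp
  next
    \<comment> \<open>Both densities vanish, so each side has a zero factor, whatever value the
      gradients take.\<close>
    case 3
    then show ?thesis
      by (simp add: k_def)
  qed
qed

text \<open>One factor \<open>1 - r\<close> is dropped, and the remaining \<open>(1 - r) * a\<close>
  is a summand of the denominator. For \<open>a = c = 0\<close> the quotient is \<open>0\<close> by
  the convention for division.\<close>

lemma mixture_weight_le:
  fixes a c r :: real
  assumes "0 \<le> a" "0 \<le> c" "0 < r" "r < 1"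
  shows "\<bar>(1 - r)\<^sup>2 * a / ((1 - r) * a + r * c)\<bar> \<le> 1"
proof -
  have "(1 - r)\<^sup>2 * a \<le> (1 - r) * a"
    using assms by (intro mult_right_mono) (auto simp: power2_eq_square mult_left_le)
  also have "\<dots> \<le> (1 - r) * a + r * c"
    using assms by simp
  finally have "(1 - r)\<^sup>2 * a \<le> (1 - r) * a + r * c" .
  moreover have "0 \<le> (1 - r)\<^sup>2 * a"
    using assms by simp
  ultimately show ?thesis
    using divide_le_eq_1[of "(1 - r)\<^sup>2 * a" "(1 - r) * a + r * c"] by (simp; linarith)
qed

lemma mixture_weight_tendsto:
  fixes a c :: real
  assumes "p \<longlonglongrightarrow> 0" "a \<noteq> 0"
  shows "(\<lambda>n. (1 - p n)\<^sup>2 * a / ((1 - p n) * a + p n * c)) \<longlonglongrightarrow> 1"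
proof -
  have "(\<lambda>n. (1 - p n)\<^sup>2 * a / ((1 - p n) * a + p n * c))
      \<longlonglongrightarrow> (1 - 0)\<^sup>2 * a / ((1 - 0) * a + 0 * c)"
    using assms by (intro tendsto_intros) auto
  with assms(2) show ?thesis
    by simp
qed

text \<open>A convex set differs from its open interior by part of its frontier, which is
  negligible.\<close>

lemma convex_lebesgue_sets:
  fixes X :: "'a::euclidean_space set"
  assumes "convex X"
  shows "X \<in> sets lebesgue"
proof -
  have "negligible (X - interior X)"
    by (rule negligible_subset[OF negligible_convex_frontier[OF assms]])
      (use closure_subset in \<open>auto simp: frontier_def\<close>)
  then have "interior X \<union> (X - interior X) \<in> sets lebesgue"
    using negligible_imp_sets by (intro sets.Un) auto
  moreover have "interior X \<union> (X - interior X) = X"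
    using interior_subset by blast
  ultimately show ?thesis
    by simp
qed

text \<open>Completeness of Lebesgue measure, carried over to \<open>X\<close> by extending both
  functions by zero.\<close>

lemma borel_measurable_lebesgue_on_AE:
  fixes v w :: "'a::euclidean_space \<Rightarrow> 'b::euclidean_space"
  assumes X: "X \<in> sets lebesgue" and v: "v \<in> borel_measurable (lebesgue_on X)"
    and ae: "AE x in lebesgue_on X. v x = w x"
  shows "w \<in> borel_measurable (lebesgue_on X)"
proof -
  have "(\<lambda>x. indicator X x *\<^sub>R v x) \<in> borel_measurable lebesgue"
    using v X by (simp add: borel_measurable_restrict_space_iff)
  moreover have "AE x in lebesgue. indicator X x *\<^sub>R v x = indicator X x *\<^sub>R w x"
    using ae X by (auto simp: AE_restrict_space_iff indicator_def elim!: eventually_mono)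
  ultimately have "(\<lambda>x. indicator X x *\<^sub>R w x) \<in> borel_measurable lebesgue"
    by (rule borel_measurable_AE)
  then show ?thesis
    using X by (simp add: borel_measurable_restrict_space_iff)
qed

theorem theorem5:
  fixes X :: "'a::euclidean_space set"
    and \<Omega> :: "(real ^ 'd) set"
    and f :: "'a \<Rightarrow> real ^ 'd \<Rightarrow> real"
    and g :: "'a \<Rightarrow> real"
    and p :: "nat \<Rightarrow> real"
    and \<theta>s :: "real ^ 'd"
  assumes "convex X" and "convex \<Omega>"
    and "\<And>\<theta>. \<theta> \<in> \<Omega> \<Longrightarrow> is_density_on X (\<lambda>x. f x \<theta>)"
    and "is_density_on X g"
    and "X \<subseteq> closure (support_on X g)"
    and "continuous_on (X \<times> \<Omega>) (\<lambda>(x, \<theta>). f x \<theta>)"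
    and "\<And>r. 0 < r \<Longrightarrow> r < 1 \<Longrightarrow>
           continuous_on (X \<times> \<Omega>) (\<lambda>(x, \<theta>). contaminated f g r x \<theta>)"
    and "\<theta>s \<in> interior \<Omega>"
    and "fisher_information_exists X f \<theta>s"
    and "\<And>n. score_exists X (contaminated f g (p n)) \<theta>s"
    and "\<And>n. 0 < p n" and "\<And>n. p n < 1"
    and "p \<longlonglongrightarrow> 0"
  shows "\<forall>i j. (\<lambda>n. fisher_information X (contaminated f g (p n)) \<theta>s $ i $ j)
                 \<longlonglongrightarrow> fisher_information X f \<theta>s $ i $ j"
proof (intro allI)
  fix i j
  let ?M = "lebesgue_on X"
  let ?k = "\<lambda>n. contaminated f g (p n)"
  let ?F = "\<lambda>x. score f \<theta>s x $ i * score f \<theta>s x $ j * f x \<theta>s"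
  let ?K = "\<lambda>n x. score (?k n) \<theta>s x $ i * score (?k n) \<theta>s x $ j * ?k n x \<theta>s"
  let ?W = "\<lambda>n x. (1 - p n)\<^sup>2 * f x \<theta>s / ((1 - p n) * f x \<theta>s + p n * g x)"
  have X: "X \<in> sets lebesgue"
    by (rule convex_lebesgue_sets) fact
  have \<theta>s: "\<theta>s \<in> \<Omega>"
    using assms(8) interior_subset by blast
  have f_nonneg: "0 \<le> f x t" if "x \<in> X" "t \<in> \<Omega>" for x t
    using assms(3)[OF that(2)] that(1) by (simp add: is_density_on_def)
  have g_nonneg: "0 \<le> g x" if "x \<in> X" for x
    using assms(4) that by (simp add: is_density_on_def)
  \<comment> \<open>Joint continuity restricts to the slice at \<open>x\<close>; as
    \<open>\<theta>s\<close> is interior to \<open>\<Omega>\<close>, continuity on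
    \<open>\<Omega>\<close> becomes continuity at the point.\<close>
  have cont: "isCont (f x) \<theta>s" if "x \<in> X" for x
  proof -
    have "continuous_on \<Omega> ((\<lambda>(x, \<theta>). f x \<theta>) \<circ> Pair x)"
      by (rule continuous_on_compose)
        (auto intro!: continuous_intros continuous_on_subset[OF assms(6)] that)
    then show ?thesis
      using assms(8) by (auto simp: comp_def intro: continuous_on_interior)
  qed
  have near: "eventually (\<lambda>t. 0 \<le> f x t) (nhds \<theta>s)" if "x \<in> X" for x
  proof -
    have "eventually (\<lambda>t. t \<in> interior \<Omega>) (nhds \<theta>s)"
      by (rule eventually_nhds_in_open) (use assms(8) in auto)
    then show ?thesis
      by eventually_elim (use interior_subset f_nonneg that in blast)
  qed
  have measf[measurable]: "(\<lambda>x. f x \<theta>s) \<in> borel_measurable ?M"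
    using assms(3)[OF \<theta>s] by (auto simp: is_density_on_def has_bochner_integral_iff)
  have measg[measurable]: "g \<in> borel_measurable ?M"
    using assms(4) by (auto simp: is_density_on_def has_bochner_integral_iff)
  have intF: "integrable ?M ?F"
    using assms(9) by (simp add: fisher_information_exists_def)
  have measF[measurable]: "?F \<in> borel_measurable ?M"
    using intF by (rule borel_measurable_integrable)
  have measFW: "(\<lambda>x. ?F x * ?W n x) \<in> borel_measurable ?M" for n
    by measurable
  have K_eq: "AE x in ?M. ?F x * ?W n x = ?K n x" for n
    using assms(10)[of n, unfolded score_exists_def] AE_space
      conjunct1[OF assms(9)[unfolded fisher_information_exists_def], unfolded score_exists_def]
  proof eventually_elim
    case (elim x)
    then have x: "x \<in> X"
      by simp
    show ?case
      using fisher_integrand_mixture[OF cont[OF x] near[OF x] g_nonneg[OF x] assms(11,12), of n i j]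
        elim
      by (simp add: score_def contaminated_def)
  qed
  \<comment> \<open>\<open>?K n\<close> involves a gradient chosen by \<open>THE\<close>, so its
    measurability is inherited from the explicit product.\<close>
  have measK: "?K n \<in> borel_measurable ?M" for n
    by (rule borel_measurable_lebesgue_on_AE[OF X measFW K_eq])
  \<comment> \<open>For the product \<open>?F x * ?W n x\<close>, limit and bound hold at every
    point of \<open>X\<close>; the null sets where scores fail to exist enter only through
    \<open>K_eq\<close>.\<close>
  have "(\<lambda>n. integral\<^sup>L ?M (\<lambda>x. ?F x * ?W n x)) \<longlonglongrightarrow> integral\<^sup>L ?M ?F"
  proof (rule integral_dominated_convergence[where w = "\<lambda>x. norm (?F x)"])
    show "AE x in ?M. (\<lambda>n. ?F x * ?W n x) \<longlonglongrightarrow> ?F x"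
    proof (rule AE_I2)
      fix x
      show "(\<lambda>n. ?F x * ?W n x) \<longlonglongrightarrow> ?F x"
      \<comment> \<open>Where \<open>f\<close> vanishes the weight does not tend to
        \<open>1\<close>, but \<open>?F x = 0\<close> makes the sequence constantly zero.\<close>
      proof (cases "f x \<theta>s = 0")
        case False
        show ?thesis
          using tendsto_mult_left[OF mixture_weight_tendsto[OF assms(13) False], of "?F x"] by simp
      qed simp
    qed
  next
    fix n
    show "AE x in ?M. norm (?F x * ?W n x) \<le> norm (?F x)"
    proof (rule AE_I2)
      fix x assume "x \<in> space ?M"
      then have x: "x \<in> X"
        by simp
      have "\<bar>?W n x\<bar> \<le> 1"
        by (rule mixture_weight_le) (use x f_nonneg g_nonneg \<theta>s assms(11,12) in auto)
      then show "norm (?F x * ?W n x) \<le> norm (?F x)"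
        unfolding norm_mult real_norm_def[of "?W n x"] by (intro mult_left_le) auto
    qed
  qed (use intF measFW measF in auto)
  moreover have "integral\<^sup>L ?M (\<lambda>x. ?F x * ?W n x) = integral\<^sup>L ?M (?K n)" for n
    by (rule integral_cong_AE[OF measFW measK K_eq])
  ultimately show "(\<lambda>n. fisher_information X (?k n) \<theta>s $ i $ j)
      \<longlonglongrightarrow> fisher_information X f \<theta>s $ i $ j"
    by (simp add: fisher_information_def)
qed

end
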